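(* In the semi-synchronous Passive Transport (PT) model, any exploration algorithm on a 1-interval connected ring of size $n\ge 3$ with two anonymous agents can only guarantee partial termination; that is, no algorithm solves exploration with explicit termination of both agents. The result holds even if the size of the ring is known, a landmark node is present and there is chirality.
   Context: Ring: the nodes $v_0,\dots,v_{n-1}$ (indices modulo $n$) form a cycle; $v_i$ is linked to $v_{i-1}$ and $v_{i+1}$ via distinctly labelled ports $q_{i-}$ and $q_{i+}$ (labels need not be globally consistent). Time proceeds in rounds; in each round at most one edge, chosen by an adversary, is missing (1-interval connected ring). Landmark: one node is different from all others, and an agent performing Look at a node sees whether that node is the landmark; the nodes are otherwise indistinguishable. Agents: each has memory and computational power; they are anonymous (no identifiers) and all execute the same deterministic protocol. They start at arbitrary, not necessarily distinct, nodes, cannot communicate explicitly and cannot mark nodes. Each agent $a_j$ has a consistent private orientation, i.e. a function $\lambda_j$ designating each port left or right with $\lambda_j(q_{i-})=\lambda_j(q_{k-})$ for all $i,k$. Chirality: all agents have the same orientation and are aware of it. Round: each active agent performs Look (it sees its own position within its node, i.e. whether it is on a port and which one, and the positions of the other agents at that node), Compute (from this snapshot and its memory it determines a direction in $\{left,right,nil\}$; if $nil$ it becomes inactive; otherwise it tries to access the corresponding port if not already there), and Move. Ports are accessed in mutual exclusion: an occupied port cannot be gained, and if several agents try the same port exactly one succeeds; an agent that fails sets $moved=false$ and becomes inactive. An agent on a port after computing moves to the other endpoint if the edge is present in this round (setting $moved=true$), and otherwise stays on the port (setting $moved=false$); in either case the port is denied to other agents in that round. Two agents crossing the same edge in opposite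 directions in the same round might not detect each other. Semi-synchronous ($\mathcal{SSYNC}$): in each round an adversary activates a non-empty subset of the agents, the others being asleep (passive); every agent is activated infinitely often; an activated agent does not know whether it was active in the previous round. An agent may be asleep on a port. PT model: if an agent is sleeping on a port in round $t$ and the corresponding edge is present in round $t$, the agent is moved to the other endpoint of the edge in round $t$. Exploration is solved if within finite time every node is visited by at least one agent, in every execution (all initial positions and all adversary choices of activations and missing edges). It is with explicit termination (resp. partial termination) if every agent (resp. at least one agent), within finite time, enters a terminal state and no longer moves; a terminal state may be entered only after the ring has been explored. *)

theory Defs
  imports Main
begin

section \<open>The ring\<close>

text \<open>The nodes are the numbers below \<open>n\<close>. Edge \<open>i\<close> joins node \<open>i\<close> and node \<open>(i + 1) mod n\<close>.
  \<open>Minus\<close> and \<open>Plus\<close> stand for the two ports of a node; they are invisible to the agents, which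
  see ports only through their private orientation.\<close>

datatype side = Minus | Plus

fun neighbour :: "nat \<Rightarrow> nat \<Rightarrow> side \<Rightarrow> nat" where
  "neighbour n i Plus = (i + 1) mod n"
| "neighbour n i Minus = (i + n - 1) mod n"

fun edge_at :: "nat \<Rightarrow> nat \<Rightarrow> side \<Rightarrow> nat" where
  "edge_at n i Plus = i"
| "edge_at n i Minus = (i + n - 1) mod n"

section \<open>Agents and protocols\<close>

datatype agent = A | B

fun other_agent :: "agent \<Rightarrow> agent" where
  "other_agent A = B"
| "other_agent B = A"

datatype direction = Left | Right

datatype place = Inside | On_Port direction

text \<open>Since there are only two agents, the positions of the other agents at the node are
  \<open>None\<close> (nobody else is here) or \<open>Some\<close> of a single place. Whether that other agent is asleep
  or terminated cannot be seen. The component \<open>last_moved\<close> is the variable \<open>moved\<close> of the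
  agent itself.\<close>

record snapshot =
  own_place :: place
  other_place :: "place option"
  at_landmark :: bool
  last_moved :: bool

text \<open>The direction \<open>nil\<close> is \<open>None\<close>. A protocol receives no identifier and no round number. The
  type of memory states is arbitrary, and a protocol for a ring of known size is one that may be
  chosen depending on the size.\<close>

record 'm protocol =
  start_memory :: 'm
  compute :: "snapshot \<Rightarrow> 'm \<Rightarrow> 'm \<times> direction option"
  terminal :: "'m \<Rightarrow> bool"

text \<open>The component \<open>port\<close> is \<open>None\<close> if the agent is inside its node.\<close>

record 'm agent_state =
  node :: nat
  port :: "side option"
  memory :: 'm
  moved :: bool

type_synonym 'm config = "agent \<Rightarrow> 'm agent_state"

text \<open>An orientation maps the two ports of a node to left and right. It does not take the node as
  an argument, which makes it consistent around the ring.\<close>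

type_synonym orientation = "side \<Rightarrow> direction"

fun place_of :: "orientation \<Rightarrow> side option \<Rightarrow> place" where
  "place_of f None = Inside"
| "place_of f (Some s) = On_Port (f s)"

definition look :: "nat option \<Rightarrow> (agent \<Rightarrow> orientation) \<Rightarrow> 'm config \<Rightarrow> agent \<Rightarrow> snapshot" where
  "look landmark ori c j =
    \<lparr> own_place = place_of (ori j) (port (c j)),
      other_place =
        (if node (c (other_agent j)) = node (c j)
         then Some (place_of (ori j) (port (c (other_agent j)))) else None),
      at_landmark = (landmark = Some (node (c j))),
      last_moved = moved (c j) \<rparr>"

definition new_memory ::
  "'m protocol \<Rightarrow> nat option \<Rightarrow> (agent \<Rightarrow> orientation) \<Rightarrow> 'm config \<Rightarrow> agent \<Rightarrow> 'm" where
  "new_memory P landmark ori c j = fst (compute P (look landmark ori c j) (memory (c j)))"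

text \<open>The port that an activated agent wants to use. Agents that are in a terminal state, or enter
  one in this round, do not try to move.\<close>

definition target ::
  "'m protocol \<Rightarrow> nat option \<Rightarrow> (agent \<Rightarrow> orientation) \<Rightarrow> 'm config \<Rightarrow> agent \<Rightarrow> side option" where
  "target P landmark ori c j =
    (if terminal P (memory (c j)) \<or> terminal P (new_memory P landmark ori c j) then None
     else map_option (inv (ori j)) (snd (compute P (look landmark ori c j) (memory (c j)))))"

section \<open>Rounds\<close>

definition occupied :: "'m config \<Rightarrow> nat \<Rightarrow> side \<Rightarrow> bool" where
  "occupied c v s \<longleftrightarrow> (\<exists>k. node (c k) = v \<and> port (c k) = Some s)"

text \<open>\<open>G\<close> is a possible set of agents that end up on the port they want, when the agents in \<open>S\<close>
  are activated and \<open>want\<close> gives their target ports. A port that is occupied at the beginning of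
  the round cannot be gained by another agent in this round, even if its occupant leaves it.\<close>

definition access_outcome ::
  "'m config \<Rightarrow> agent set \<Rightarrow> (agent \<Rightarrow> side option) \<Rightarrow> agent set \<Rightarrow> bool" where
  "access_outcome c S want G \<longleftrightarrow>
    G \<subseteq> {j \<in> S. want j \<noteq> None} \<and>
    (\<forall>j\<in>S. \<forall>s. want j = Some s \<longrightarrow>
      (if port (c j) = Some s then j \<in> G
       else if occupied c (node (c j)) s then j \<notin> G
       else \<exists>!k. k \<in> G \<and> node (c k) = node (c j) \<and> want k = Some s))"

text \<open>Traversing the edge behind port \<open>s\<close> ends inside the other endpoint.\<close>

definition present :: "nat \<Rightarrow> nat option \<Rightarrow> nat \<Rightarrow> side \<Rightarrow> bool" where
  "present n missing v s \<longleftrightarrow> missing \<noteq> Some (edge_at n v s)"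

definition active_update ::
  "nat \<Rightarrow> nat option \<Rightarrow> bool \<Rightarrow> side option \<Rightarrow> 'm \<Rightarrow> 'm agent_state \<Rightarrow> 'm agent_state" where
  "active_update n missing granted want m a =
    (case want of
       None \<Rightarrow> a\<lparr>memory := m\<rparr>
     | Some s \<Rightarrow>
         if \<not> granted then a\<lparr>memory := m, moved := False\<rparr>
         else if present n missing (node a) s
         then \<lparr>node = neighbour n (node a) s, port = None, memory = m, moved = True\<rparr>
         else \<lparr>node = node a, port = Some s, memory = m, moved = False\<rparr>)"

text \<open>Passive transport. The agent does not act, so its variable \<open>moved\<close> is left alone.\<close>

definition asleep_update ::
  "nat \<Rightarrow> nat option \<Rightarrow> 'm agent_state \<Rightarrow> 'm agent_state" where
  "asleep_update n missing a =
    (case port a of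
       None \<Rightarrow> a
     | Some s \<Rightarrow>
         if present n missing (node a) s
         then a\<lparr>node := neighbour n (node a) s, port := None\<rparr> else a)"

text \<open>A terminated agent no longer moves: whether activated or not, and also if it terminated on a
  port, it stays where it is.\<close>

definition round_step ::
  "'m protocol \<Rightarrow> nat \<Rightarrow> nat option \<Rightarrow> (agent \<Rightarrow> orientation) \<Rightarrow>
   agent set \<Rightarrow> nat option \<Rightarrow> 'm config \<Rightarrow> 'm config \<Rightarrow> bool" where
  "round_step P n landmark ori S missing c c' \<longleftrightarrow>
    (\<exists>G. access_outcome c S (target P landmark ori c) G \<and>
      (\<forall>j. c' j =
        (if terminal P (memory (c j)) then c j
         else if j \<in> S
         then active_update n missing (j \<in> G) (target P landmark ori c j)
                (new_memory P landmark ori c j) (c j)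
         else asleep_update n missing (c j))))"

section \<open>Executions and exploration\<close>

definition initial :: "'m protocol \<Rightarrow> nat \<Rightarrow> 'm config \<Rightarrow> bool" where
  "initial P n c \<longleftrightarrow>
    (\<forall>j. node (c j) < n \<and> port (c j) = None \<and> memory (c j) = start_memory P \<and> \<not> moved (c j))"

text \<open>\<open>S t\<close> and \<open>missing t\<close> are the agents activated and the edge removed in round \<open>t\<close>, which
  leads from \<open>c t\<close> to \<open>c (Suc t)\<close>.\<close>

definition execution ::
  "'m protocol \<Rightarrow> nat \<Rightarrow> nat option \<Rightarrow> (agent \<Rightarrow> orientation) \<Rightarrow>
   (nat \<Rightarrow> agent set) \<Rightarrow> (nat \<Rightarrow> nat option) \<Rightarrow> (nat \<Rightarrow> 'm config) \<Rightarrow> bool" where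
  "execution P n landmark ori S missing c \<longleftrightarrow>
    initial P n (c 0) \<and>
    (\<forall>t. S t \<noteq> {}) \<and>
    (\<forall>j t. \<exists>t'\<ge>t. j \<in> S t') \<and>
    (\<forall>t e. missing t = Some e \<longrightarrow> e < n) \<and>
    (\<forall>t. round_step P n landmark ori (S t) (missing t) (c t) (c (Suc t)))"

definition explored :: "nat \<Rightarrow> (nat \<Rightarrow> 'm config) \<Rightarrow> nat \<Rightarrow> bool" where
  "explored n c t \<longleftrightarrow> (\<forall>v<n. \<exists>j. \<exists>t'\<le>t. node (c t' j) = v)"

definition explores_and_terminates ::
  "'m protocol \<Rightarrow> nat \<Rightarrow> (nat \<Rightarrow> 'm config) \<Rightarrow> bool" where
  "explores_and_terminates P n c \<longleftrightarrow>
    (\<exists>t. explored n c t) \<and>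
    (\<forall>j. \<exists>t. terminal P (memory (c t j))) \<and>
    (\<forall>j t. terminal P (memory (c t j)) \<longrightarrow> explored n c t)"

definition orientations :: "bool \<Rightarrow> (agent \<Rightarrow> orientation) set" where
  "orientations chirality = {ori. (\<forall>j. bij (ori j)) \<and> (chirality \<longrightarrow> ori A = ori B)}"

text \<open>With \<open>landmark = None\<close> there is no landmark; with \<open>chirality = False\<close> the protocol has to
  cope with all combinations of orientations.\<close>

definition solves_exploration_with_explicit_termination ::
  "nat \<Rightarrow> nat option \<Rightarrow> bool \<Rightarrow> 'm protocol \<Rightarrow> bool" where
  "solves_exploration_with_explicit_termination n landmark chirality P \<longleftrightarrow>
    (\<forall>ori S missing c. ori \<in> orientations chirality \<longrightarrow>
       execution P n landmark ori S missing c \<longrightarrow> explores_and_terminates P n c)"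

end

theory Submission
  imports Defs
begin

text \<open>Call an agent persistent if it never terminates when, alone at its node, it is blocked in
  every round. As long as both agents are inside distinct nodes and one of them is persistent, the
  other is persistent too: otherwise it would terminate while blocked, and the persistent agent
  could be blocked forever afterwards. At the start both are persistent because, when they start
  apart and one is blocked, only two nodes are ever visited. So every move of a single agent that
  does not end in a meeting leads again to two persistent agents inside distinct nodes. If the only
  edges that the agents ever want lead to each other, they want the same edge, which can be removed
  forever; otherwise some agent can move without meeting the other one, which frees the way of the
  other. Hence the agents can be kept apart and running forever.\<close>

section \<open>Agents and ring arithmetic\<close>

lemma other_agent_simps [simp]:
  "other_agent j \<noteq> j" "j \<noteq> other_agent j" "other_agent (other_agent j) = j"
  by (cases j; simp)+

lemma neq_agent_iff: "k \<noteq> j \<longleftrightarrow> k = other_agent j"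
  by (cases j; cases k) auto

lemma neighbour_less: "0 < n \<Longrightarrow> neighbour n v s < n"
  by (cases s) auto

lemma edge_at_less: "v < n \<Longrightarrow> edge_at n v s < n"
  by (cases s) auto

lemma minus_node_mod: "v < n \<Longrightarrow> (v + n - Suc 0) mod n = (if v = 0 then n - 1 else v - 1)" for v n :: nat
  by (auto simp: mod_if)

lemma plus_node_mod: "v < n \<Longrightarrow> Suc v mod n = (if v = n - 1 then 0 else v + 1)" for v n :: nat
  by (auto simp: mod_if)

lemma neighbour_neq:
  assumes "3 \<le> n" "v < n"
  shows "neighbour n v s \<noteq> v"
  using assms by (cases s) (auto simp: minus_node_mod plus_node_mod split: if_splits)

text \<open>Size 3 matters here: on a ring of two nodes, two parallel edges join them, and two
  agents heading for each other could not be stopped by removing a single edge.\<close>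

lemma connecting_edge_unique:
  assumes "3 \<le> n" "v < n" "w < n" "neighbour n v s = w" "neighbour n w r = v"
  shows "edge_at n v s = edge_at n w r"
  using assms
  by (cases s; cases r) (auto simp: minus_node_mod plus_node_mod split: if_splits)

lemma neighbour_inj:
  assumes "3 \<le> n" "v < n" "neighbour n v s = neighbour n v r"
  shows "s = r"
  using assms
  by (cases s; cases r) (auto simp: minus_node_mod plus_node_mod split: if_splits)

text \<open>A single orientation \<open>f\<close> is given to both agents. Such a pair lies in
  \<open>orientations chirality\<close> for either truth value, so one adversary refutes both
  settings.\<close>

locale explicit_termination =
  fixes n :: nat and landmark :: "nat option" and chirality :: bool
    and P :: "'m protocol" and f :: orientation
  assumes size: "3 \<le> n"
    and bij: "bij f"
    and solves: "solves_exploration_with_explicit_termination n landmark chirality P"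
begin

abbreviation terminated :: "'m agent_state \<Rightarrow> bool" where
  "terminated x \<equiv> terminal P (memory x)"

section \<open>Infinite executions from finite segments\<close>

fun path :: "'m config \<Rightarrow> (agent set \<times> nat option \<times> 'm config) list \<Rightarrow> bool" where
  "path c [] \<longleftrightarrow> True"
| "path c ((S, e, d) # p) \<longleftrightarrow>
    S \<noteq> {} \<and> (\<forall>i. e = Some i \<longrightarrow> i < n) \<and> round_step P n landmark (\<lambda>_. f) S e c d \<and> path d p"

fun final :: "'m config \<Rightarrow> (agent set \<times> nat option \<times> 'm config) list \<Rightarrow> 'm config" where
  "final c [] = c"
| "final c ((S, e, d) # p) = final d p"

definition configs :: "'m config \<Rightarrow> (agent set \<times> nat option \<times> 'm config) list \<Rightarrow> 'm config set" where
  "configs c p = insert c ((\<lambda>x. snd (snd x)) ` set p)"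

text \<open>The set \<open>X\<close> records finite fairness: each of its agents is activated at
  least once on the way, others possibly as well. With \<open>X = {}\<close> this is plain
  reachability.\<close>

definition leads :: "'m config \<Rightarrow> agent set \<Rightarrow> 'm config \<Rightarrow> bool" where
  "leads c X d \<longleftrightarrow> (\<exists>p. path c p \<and> final c p = d \<and> X \<subseteq> \<Union> (fst ` set p))"

lemma path_append: "path c (p @ q) \<longleftrightarrow> path c p \<and> path (final c p) q"
  by (induction p arbitrary: c) auto

lemma final_append [simp]: "final c (p @ q) = final (final c p) q"
  by (induction p arbitrary: c) auto

lemma leads_trans: "leads c X d \<Longrightarrow> leads d Y e \<Longrightarrow> leads c (X \<union> Y) e"
proof -
  assume "leads c X d" "leads d Y e"
  then obtain p q where "path c p" "final c p = d" "X \<subseteq> \<Union> (fst ` set p)"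
    "path d q" "final d q = e" "Y \<subseteq> \<Union> (fst ` set q)"
    unfolding leads_def by blast
  then show ?thesis
    unfolding leads_def by (intro exI[of _ "p @ q"]) (auto simp: path_append)
qed

lemma leads_mono: "leads c X d \<Longrightarrow> Y \<subseteq> X \<Longrightarrow> leads c Y d"
  unfolding leads_def by blast

text \<open>After \<open>p\<close>, segments that activate both agents and return to
  \<open>Q\<close> are appended forever; the concatenation is fair because each segment contains
  every agent.\<close>

lemma fair_execution:
  assumes init: "initial P n c0" and p: "path c0 p" and Q: "Q (final c0 p)"
    and closed: "\<And>c. Q c \<Longrightarrow> \<exists>d. leads c UNIV d \<and> Q d"
  obtains S e c where "execution P n landmark (\<lambda>_. f) S e c"
    "\<And>t. \<exists>t'\<ge>t. Q (c t')"
    "\<And>t. t \<le> length p \<Longrightarrow> c t \<in> configs c0 p" "c (length p) = final c0 p"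
proof -
  have "\<forall>c. \<exists>q. Q c \<longrightarrow> path c q \<and> Q (final c q) \<and> UNIV \<subseteq> \<Union> (fst ` set q)"
    using closed unfolding leads_def by blast
  then obtain ch where ch: "\<And>c. Q c \<Longrightarrow>
      path c (ch c) \<and> Q (final c (ch c)) \<and> UNIV \<subseteq> \<Union> (fst ` set (ch c))"
    by metis
  \<comment> \<open>A state is the current configuration with the rounds still to be played. An
    exhausted list is refilled by the chosen segment, which is nonempty because its activation sets
    cover all agents.\<close>
  define pend where "pend = (\<lambda>(c, p). if p = [] then ch c else p)"
  define st where "st = (\<lambda>t. ((\<lambda>x. (snd (snd (hd (pend x))), tl (pend x))) ^^ t) (c0, p))"
  define c where "c = (\<lambda>t. fst (st t))"
  define r where "r = (\<lambda>t. snd (st t))"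
  define q where "q = (\<lambda>t. pend (st t))"
  have q: "q t = (if r t = [] then ch (c t) else r t)" for t
    by (simp add: q_def pend_def c_def r_def split_beta)
  have [simp]: "c 0 = c0" "r 0 = p"
    by (simp_all add: c_def r_def st_def)
  have step: "c (Suc t) = snd (snd (hd (q t)))" "r (Suc t) = tl (q t)" for t
    by (simp_all add: c_def r_def st_def q_def)
  have q_props: "q t \<noteq> [] \<and> path (c t) (q t) \<and> Q (final (c t) (q t))"
    if "path (c t) (r t)" "Q (final (c t) (r t))" for t
  proof (cases "r t = []")
    case True
    then have "Q (c t)" using that by simp
    from ch[OF this] show ?thesis using True by (auto simp: q)
  qed (use that in \<open>simp add: q\<close>)
  have inv: "path (c t) (r t) \<and> Q (final (c t) (r t))" for t
  proof (induction t)
    case (Suc t)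
    obtain S e d p' where "q t = (S, e, d) # p'"
      using q_props Suc by (metis neq_Nil_conv prod_cases3)
    then show ?case using q_props[of t] Suc.IH by (simp add: step)
  qed (use p Q in simp)
  have qt: "q t \<noteq> []" "path (c t) (q t)" "Q (final (c t) (q t))" for t
    using q_props inv by blast+
  \<comment> \<open>The list shrinks in every round until it is empty. At these moments the current
    configuration satisfies \<open>Q\<close>.\<close>
  have pause: "\<exists>t'\<ge>t. r t' = []" for t
  proof (induction "length (r t)" arbitrary: t)
    case (Suc l)
    then have "l = length (r (Suc t))" by (cases "r t") (auto simp: step q)
    from Suc(1)[OF this] show ?case using Suc_leD by blast
  qed auto
  have played: "\<exists>t'\<ge>t. hd (q t') = x" if "x \<in> set (q t)" for x t
    using that
  proof (induction "q t" arbitrary: t)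
    case (Cons y ys)
    show ?case
    proof (cases "x = y")
      case True
      then show ?thesis using Cons.hyps(2)[symmetric] by (intro exI[of _ t]) simp
    next
      case False
      then have "x \<in> set ys" using Cons.prems Cons.hyps(2)[symmetric] by simp
      moreover have "r (Suc t) = ys" using Cons.hyps(2)[symmetric] by (simp add: step)
      ultimately have "q (Suc t) = ys" by (auto simp: q)
      with Cons.hyps(1)[of "Suc t"] \<open>x \<in> set ys\<close> show ?thesis using Suc_leD by metis
    qed
  qed simp
  define S where "S = (\<lambda>t. fst (hd (q t)))"
  define e where "e = (\<lambda>t. fst (snd (hd (q t))))"
  have rounds: "S t \<noteq> {} \<and> (\<forall>i. e t = Some i \<longrightarrow> i < n)
      \<and> round_step P n landmark (\<lambda>_. f) (S t) (e t) (c t) (c (Suc t))" for t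
    using qt(1,2)[of t] by (cases "q t") (auto simp: S_def e_def step)
  have fair: "\<exists>t'\<ge>t. j \<in> S t'" for j t
  proof -
    obtain t1 where t1: "t1 \<ge> t" "r t1 = []" using pause by blast
    then have "Q (c t1)" using inv[of t1] by simp
    from ch[OF this] have "UNIV \<subseteq> \<Union> (fst ` set (q t1))" using t1(2) by (simp add: q)
    then obtain x where "x \<in> set (q t1)" "j \<in> fst x" by blast
    with played[of x t1] t1(1) show ?thesis unfolding S_def by (metis le_trans)
  qed
  have "execution P n landmark (\<lambda>_. f) S e c"
    unfolding execution_def using init rounds fair by simp
  moreover have "\<exists>t'\<ge>t. Q (c t')" for t
    using pause[of t] inv by (metis final.simps(1))
  moreover have prefix: "r t = drop t p \<and> c t \<in> configs c0 p \<and> final (c t) (r t) = final c0 p"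
    if "t \<le> length p" for t
    using that
  proof (induction t)
    case (Suc t)
    then have IH: "r t = drop t p" "final (c t) (r t) = final c0 p" by (meson Suc_leD)+
    from Suc have "r t = p ! t # drop (Suc t) p" using IH by (simp add: Cons_nth_drop_Suc)
    moreover obtain S e d where "p ! t = (S, e, d)" by (cases "p ! t")
    moreover have "p ! t \<in> set p" using Suc by simp
    ultimately show ?case using IH(2) by (force simp: step q configs_def)
  qed (simp add: configs_def)
  ultimately show ?thesis using that prefix[of "length p"] by simp
qed

definition reachable :: "'m config \<Rightarrow> bool" where
  "reachable c \<longleftrightarrow> (\<exists>c0 X. initial P n c0 \<and> leads c0 X c)"

lemma reachable_leads: "reachable c \<Longrightarrow> leads c X d \<Longrightarrow> reachable d"
  unfolding reachable_def using leads_trans by blast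

lemma execution_outcome:
  assumes "execution P n landmark (\<lambda>_. f) S e c"
  shows "explores_and_terminates P n c"
  using solves assms bij
  unfolding solves_exploration_with_explicit_termination_def orientations_def by auto

lemma execution_terminated_mono:
  assumes "execution P n landmark (\<lambda>_. f) S e c" "terminated (c t j)" "t \<le> t'"
  shows "terminated (c t' j)"
  using assms(3)
proof (induction rule: dec_induct)
  case (step t')
  have "round_step P n landmark (\<lambda>_. f) (S t') (e t') (c t') (c (Suc t'))"
    using assms(1) unfolding execution_def by blast
  then have "c (Suc t') j = c t' j" using step by (auto simp: round_step_def)
  then show ?case using step by simp
qed (use assms in simp)

text \<open>The assumed protocol must terminate \<open>j\<close> in the fair execution that keeps
  returning to \<open>Q\<close>. Terminal states are permanent, so \<open>j\<close> is still
  terminated at the next return.\<close>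

lemma recurrent_terminated:
  assumes "reachable c" "Q c" and closed: "\<And>c. Q c \<Longrightarrow> \<exists>d. leads c UNIV d \<and> Q d"
  shows "\<exists>d. Q d \<and> terminated (d j)"
proof -
  obtain c0 p where "initial P n c0" "path c0 p" "Q (final c0 p)"
    using assms(1,2) unfolding reachable_def leads_def by blast
  from fair_execution[OF this closed] obtain S e d
    where d: "execution P n landmark (\<lambda>_. f) S e d" "\<And>t. \<exists>t'\<ge>t. Q (d t')" by metis
  obtain t where "terminated (d t j)"
    using execution_outcome[OF d(1)] unfolding explores_and_terminates_def by blast
  then show ?thesis using execution_terminated_mono[OF d(1)] d(2) by blast
qed

text \<open>Correctness is stated for infinite executions only; closedness of \<open>Q\<close>
  serves to extend \<open>p\<close> to one. All nodes must then have been seen by the end of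
  \<open>p\<close>.\<close>

lemma terminated_explored:
  assumes "initial P n c0" "path c0 p" "Q (final c0 p)"
    and closed: "\<And>c. Q c \<Longrightarrow> \<exists>d. leads c UNIV d \<and> Q d"
    and "terminated (final c0 p j)" "v < n"
  shows "\<exists>c\<in>configs c0 p. \<exists>k. node (c k) = v"
proof -
  from fair_execution[OF assms(1-4)] obtain S e d
    where d: "execution P n landmark (\<lambda>_. f) S e d"
      "\<And>t. t \<le> length p \<Longrightarrow> d t \<in> configs c0 p" "d (length p) = final c0 p" by metis
  have "explored n d (length p)"
    using execution_outcome[OF d(1)] assms(5) d(3) unfolding explores_and_terminates_def by metis
  then show ?thesis using assms(6) d(2) unfolding explored_def by blast
qed

section \<open>Agents that see nobody\<close>

definition solo_compute :: "'m agent_state \<Rightarrow> 'm \<times> direction option" where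
  "solo_compute x = compute P
    \<lparr> own_place = place_of f (port x), other_place = None,
      at_landmark = (landmark = Some (node x)), last_moved = moved x \<rparr> (memory x)"

definition solo_target :: "'m agent_state \<Rightarrow> side option" where
  "solo_target x = (if terminated x \<or> terminal P (fst (solo_compute x)) then None
    else map_option (inv f) (snd (solo_compute x)))"

definition solo_step :: "nat option \<Rightarrow> 'm agent_state \<Rightarrow> 'm agent_state" where
  "solo_step e x = (if terminated x then x
    else active_update n e True (solo_target x) (fst (solo_compute x)) x)"

text \<open>The missing edge is the one that the agent wants at this very moment, so iterating
  \<open>blocked\<close> follows an adversary that adapts to the agent and holds it at its
  node.\<close>

definition blocked :: "'m agent_state \<Rightarrow> 'm agent_state" where
  "blocked x = solo_step (map_option (edge_at n (node x)) (solo_target x)) x"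

definition persistent :: "'m agent_state \<Rightarrow> bool" where
  "persistent x \<longleftrightarrow> (\<forall>i. \<not> terminated ((blocked ^^ i) x))"

lemma node_blocked [simp]: "node (blocked x) = node x"
  by (simp add: blocked_def solo_step_def active_update_def present_def split: option.split)

lemma node_blocked_funpow [simp]: "node ((blocked ^^ i) x) = node x"
  by (induction i) auto

lemma solo_step_blocked:
  "(\<And>s. solo_target x = Some s \<Longrightarrow> e = Some (edge_at n (node x) s)) \<Longrightarrow> solo_step e x = blocked x"
  by (cases "solo_target x") (auto simp: blocked_def solo_step_def active_update_def)

lemma blocked_terminated:
  assumes "terminated x"
  shows "(blocked ^^ i) x = x"
  using assms by (induction i) (auto simp: blocked_def solo_step_def)

lemma persistent_not_terminated: "persistent x \<Longrightarrow> \<not> terminated x"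
  unfolding persistent_def by (metis funpow_0)

lemma persistent_blocked_funpow: "persistent x \<Longrightarrow> persistent ((blocked ^^ i) x)"
  unfolding persistent_def by (metis comp_apply funpow_add)

text \<open>At distinct nodes the agents neither see each other nor compete for a port, so a round
  splits into independent updates of the two states.\<close>

lemma round_step_apart:
  assumes "node (c A) \<noteq> node (c B)"
  shows "round_step P n landmark (\<lambda>_. f) S e c
    (\<lambda>j. if j \<in> S then solo_step e (c j)
         else if terminated (c j) then c j else asleep_update n e (c j))"
proof -
  have apart: "node (c j) \<noteq> node (c (other_agent j))" for j
    using assms by (cases j) auto
  then have same: "node (c k) = node (c j) \<longleftrightarrow> k = j" for j k
    by (metis neq_agent_iff)
  have look: "look landmark (\<lambda>_. f) c j =
      \<lparr> own_place = place_of f (port (c j)), other_place = None,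
        at_landmark = (landmark = Some (node (c j))), last_moved = moved (c j) \<rparr>" for j
    using apart[of j] by (simp add: look_def)
  have mem: "new_memory P landmark (\<lambda>_. f) c j = fst (solo_compute (c j))" for j
    by (simp add: new_memory_def look solo_compute_def)
  have tgt: "target P landmark (\<lambda>_. f) c j = solo_target (c j)" for j
    by (simp add: target_def solo_target_def mem look) (simp add: solo_compute_def)
  \<comment> \<open>Without rivals, every activated agent with a target is granted its port.\<close>
  show ?thesis
    unfolding round_step_def mem tgt
    by (intro exI[of _ "{j \<in> S. solo_target (c j) \<noteq> None}"])
      (auto simp: access_outcome_def occupied_def same tgt solo_step_def active_update_def
        split: option.split)
qed

text \<open>An agent asleep on a port could be carried along passively. Being inside its node or
  terminated keeps the inactive agent unchanged.\<close>

lemma path_solo: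
  assumes "node (c A) \<noteq> node (c B)" "\<And>i. e = Some i \<Longrightarrow> i < n"
    and "port (c (other_agent j)) = None \<or> terminated (c (other_agent j))"
  shows "path c [({j}, e, c(j := solo_step e (c j)))]"
proof -
  have "(\<lambda>k. if k \<in> {j} then solo_step e (c k)
         else if terminated (c k) then c k else asleep_update n e (c k)) = c(j := solo_step e (c j))"
    using assms(3) by (auto simp: fun_eq_iff neq_agent_iff asleep_update_def)
  then show ?thesis
    using round_step_apart[OF assms(1), of "{j}" e] assms(2) by simp
qed

lemma blocked_edge_less:
  assumes "v < n"
  shows "map_option (edge_at n v) t = Some i \<Longrightarrow> i < n"
  using edge_at_less[OF assms] by auto

text \<open>Only \<open>j\<close> is activated, each time with its wanted edge removed. That no node
  changes matters later, for counting the nodes visited before a termination.\<close>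

lemma blocked_path:
  assumes "node (c A) \<noteq> node (c B)" "node (c j) < n"
    and "port (c (other_agent j)) = None \<or> terminated (c (other_agent j))"
  shows "\<exists>p. path c p \<and> final c p = c(j := (blocked ^^ i) (c j))
    \<and> (\<forall>d\<in>configs c p. \<forall>k. node (d k) = node (c k))"
proof (induction i)
  case 0
  show ?case by (rule exI[of _ "[]"]) (simp add: configs_def)
next
  case (Suc i)
  then obtain p where p: "path c p" "final c p = c(j := (blocked ^^ i) (c j))"
    "\<forall>d\<in>configs c p. \<forall>k. node (d k) = node (c k)" by blast
  let ?d = "final c p"
  let ?e = "map_option (edge_at n (node (?d j))) (solo_target (?d j))"
  have d: "node (?d k) = node (c k)" "?d (other_agent j) = c (other_agent j)" for k
    using p(2) by auto
  let ?d' = "c(j := (blocked ^^ Suc i) (c j))"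
  have "node (?d A) \<noteq> node (?d B)" using assms(1) d(1) by metis
  moreover have "i < n" if "?e = Some i" for i
    using that by (rule blocked_edge_less[rotated]) (use assms(2) d(1) in metis)
  moreover have "port (?d (other_agent j)) = None \<or> terminated (?d (other_agent j))"
    using assms(3) d(2) by metis
  ultimately have "path ?d [({j}, ?e, ?d(j := solo_step ?e (?d j)))]"
    by (rule path_solo[of ?d ?e j])
  moreover have "?d(j := solo_step ?e (?d j)) = ?d'"
    using p(2) by (simp add: blocked_def)
  ultimately have "path c (p @ [({j}, ?e, ?d')])"
    using p(1) by (simp only: path_append)
  moreover have "\<forall>d\<in>configs c (p @ [({j}, ?e, ?d')]). \<forall>k. node (d k) = node (c k)"
    using p(3) unfolding configs_def by simp
  moreover have "final c (p @ [({j}, ?e, ?d')]) = ?d'" by simp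
  ultimately show ?case by blast
qed

section \<open>Standoffs: one missing edge per round stops both agents\<close>

definition standoff :: "'m config \<Rightarrow> bool" where
  "standoff c \<longleftrightarrow> node (c A) \<noteq> node (c B) \<and> (\<forall>j. node (c j) < n) \<and>
    (\<forall>i. \<exists>e. \<forall>j s. solo_target ((blocked ^^ i) (c j)) = Some s \<longrightarrow> e = edge_at n (node (c j)) s)"

text \<open>Both agents are activated together, so their numbers of blocked steps stay equal and the
  common edge for that number, which may vary from round to round, stops both.\<close>

lemma standoff_closed:
  assumes "standoff c"
  shows "leads c UNIV (\<lambda>j. blocked (c j))" "standoff (\<lambda>j. blocked (c j))"
proof -
  have "\<forall>i. \<exists>e. \<forall>j s. solo_target ((blocked ^^ Suc i) (c j)) = Some s \<longrightarrow> e = edge_at n (node (c j)) s"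
    using assms unfolding standoff_def by blast
  then show "standoff (\<lambda>j. blocked (c j))"
    using assms unfolding standoff_def by (simp add: funpow_swap1)
  obtain e where e: "\<And>j s. solo_target ((blocked ^^ 0) (c j)) = Some s \<Longrightarrow> e = edge_at n (node (c j)) s"
    using assms unfolding standoff_def by metis
  \<comment> \<open>If nobody wants to move, \<open>e\<close> is arbitrary and need not be an edge
    of the ring, so nothing is removed.\<close>
  define m where "m = (if \<exists>j. solo_target (c j) \<noteq> None then Some e else None)"
  have "solo_step m (c j) = blocked (c j)" for j
    by (rule solo_step_blocked) (use e[of j] in \<open>auto simp: m_def\<close>)
  then have "round_step P n landmark (\<lambda>_. f) UNIV m c (\<lambda>j. blocked (c j))"
    using round_step_apart[of c UNIV m] assms by (simp add: standoff_def)
  moreover have "i < n" if "m = Some i" for i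
    using that e assms edge_at_less by (fastforce simp: m_def standoff_def split: if_splits)
  ultimately show "leads c UNIV (\<lambda>j. blocked (c j))"
    unfolding leads_def by (intro exI[of _ "[(UNIV, m, \<lambda>j. blocked (c j))]"]) auto
qed

text \<open>A standoff can be kept up forever with both agents active, so both must terminate in it,
  which a persistent agent never does while blocked.\<close>

lemma standoff_not_persistent:
  assumes "reachable c" "standoff c"
  shows "\<not> persistent (c j)"
proof
  assume "persistent (c j)"
  then have "standoff c \<and> persistent (c j)" using assms by simp
  moreover have "\<exists>d'. leads d UNIV d' \<and> standoff d' \<and> persistent (d' j)"
    if "standoff d \<and> persistent (d j)" for d
    using that standoff_closed[of d] persistent_blocked_funpow[of "d j" 1]
    by (intro exI[of _ "\<lambda>j. blocked (d j)"]) simp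
  ultimately obtain d where "persistent (d j)" "terminated (d j)"
    using recurrent_terminated[OF assms(1), of "\<lambda>c. standoff c \<and> persistent (c j)" j] by blast
  then show False using persistent_not_terminated by blast
qed

lemma standoff_terminated:
  assumes "node (c A) \<noteq> node (c B)" "\<And>j. node (c j) < n" "terminated (c j)"
  shows "standoff c"
proof -
  have none: "solo_target ((blocked ^^ i) (c j)) = None" for i
    using blocked_terminated[OF assms(3), of i] assms(3) by (simp add: solo_target_def)
  have "\<exists>e. \<forall>k s. solo_target ((blocked ^^ i) (c k)) = Some s \<longrightarrow> e = edge_at n (node (c k)) s" for i
  proof (intro exI allI impI)
    fix k s
    assume s: "solo_target ((blocked ^^ i) (c k)) = Some s"
    with none have "k \<noteq> j" by auto
    then have "k = other_agent j" by (simp only: neq_agent_iff)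
    \<comment> \<open>The witness is the edge wanted by the agent other than \<open>j\<close>. If it
      wants none, the premise fails and the value of \<open>the\<close> is irrelevant.\<close>
    then show "edge_at n (node (c (other_agent j)))
        (the (solo_target ((blocked ^^ i) (c (other_agent j))))) = edge_at n (node (c k)) s"
      using s by simp
  qed
  then show ?thesis using assms(1,2) unfolding standoff_def by blast
qed

text \<open>The other agent sleeps inside its node while \<open>j\<close> is blocked until it
  terminates. From then on at most one agent wants an edge, which gives a standoff.\<close>

lemma termination_of_nonpersistent:
  assumes "node (c A) \<noteq> node (c B)" "\<And>j. node (c j) < n" "port (c (other_agent j)) = None"
    and "\<not> persistent (c j)"
  shows "\<exists>p. path c p \<and> standoff (final c p) \<and> terminated (final c p j)
    \<and> final c p (other_agent j) = c (other_agent j)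
    \<and> (\<forall>d\<in>configs c p. \<forall>k. node (d k) = node (c k))"
proof -
  obtain i where i: "terminated ((blocked ^^ i) (c j))"
    using assms(4) unfolding persistent_def by blast
  obtain p where p: "path c p" "final c p = c(j := (blocked ^^ i) (c j))"
    "\<forall>d\<in>configs c p. \<forall>k. node (d k) = node (c k)"
    using blocked_path[of c j, OF assms(1,2) disjI1[OF assms(3)]] by blast
  have nodes: "node (final c p k) = node (c k)" for k using p(2) by simp
  have fin: "terminated (final c p j)" using i p(2) by simp
  have "standoff (final c p)"
    by (rule standoff_terminated[of "final c p" j, OF _ _ fin]) (simp_all only: nodes assms(1,2) not_False_eq_True)
  then show ?thesis using p fin by (intro exI[of _ p]) simp
qed

text \<open>Otherwise \<open>j\<close> could terminate when only the two starting nodes have been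
  visited, fewer than the ring has.\<close>

lemma initial_persistent:
  assumes "initial P n c" "node (c A) \<noteq> node (c B)"
  shows "persistent (c j)"
proof (rule ccontr)
  assume "\<not> persistent (c j)"
  have "\<And>j. node (c j) < n" "port (c (other_agent j)) = None"
    using assms(1) by (auto simp: initial_def)
  from termination_of_nonpersistent[of c j, OF assms(2) this \<open>\<not> persistent (c j)\<close>] obtain p
    where p: "path c p" "standoff (final c p)" "terminated (final c p j)"
      "\<forall>d\<in>configs c p. \<forall>k. node (d k) = node (c k)" by (elim exE conjE)
  have closed: "\<exists>d. leads c UNIV d \<and> standoff d" if "standoff c" for c
    using standoff_closed[OF that] by blast
  have "\<exists>k. node (c k) = v" if "v < n" for v
  proof -
    obtain d k where "d \<in> configs c p" "node (d k) = v"
      using terminated_explored[OF assms(1) p(1), of standoff j v, OF p(2) closed p(3) \<open>v < n\<close>] by blast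
    then show ?thesis using p(4) by auto
  qed
  moreover have "node (c k) \<in> {node (c A), node (c B)}" for k by (cases k) simp_all
  ultimately have "{..<n} \<subseteq> {node (c A), node (c B)}" by fastforce
  from card_mono[OF _ this] have "n \<le> card {node (c A), node (c B)}" by simp
  also have "\<dots> = 2" using assms(2) by simp
  finally show False using size by simp
qed

section \<open>The invariant of the adversary\<close>

text \<open>Both ports are empty so that either agent can be left asleep without being
  transported.\<close>

definition running :: "'m config \<Rightarrow> bool" where
  "running c \<longleftrightarrow> reachable c \<and> node (c A) \<noteq> node (c B) \<and>
    (\<forall>j. node (c j) < n \<and> port (c j) = None \<and> persistent (c j))"

lemma persistent_transfer:
  assumes "reachable c" "node (c A) \<noteq> node (c B)" "\<And>j. node (c j) < n"
    and "port (c (other_agent j)) = None" "persistent (c (other_agent j))"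
  shows "persistent (c j)"
proof (rule ccontr)
  assume "\<not> persistent (c j)"
  from termination_of_nonpersistent[of c j, OF assms(2-4) this] obtain p
    where p: "path c p" "standoff (final c p)"
      "final c p (other_agent j) = c (other_agent j)" by (elim exE conjE)
  have "leads c {} (final c p)" using p(1) unfolding leads_def by blast
  then have "reachable (final c p)" by (rule reachable_leads[OF assms(1)])
  from standoff_not_persistent[OF this p(2), of "other_agent j"] show False
    using assms(5) p(3) by simp
qed

text \<open>The number \<open>i\<close> lets the adversary first hold \<open>j\<close> for a while,
  until it wants an edge that does not lead to the other agent.\<close>

definition can_evade :: "'m config \<Rightarrow> agent \<Rightarrow> bool" where
  "can_evade c j \<longleftrightarrow> (\<exists>i s. solo_target ((blocked ^^ i) (c j)) = Some s \<and>
    neighbour n (node (c j)) s \<noteq> node (c (other_agent j)))"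

lemma running_move:
  assumes "running c" "can_evade c j"
  shows "\<exists>d. leads c {j} d \<and> running d \<and> d (other_agent j) = c (other_agent j)
    \<and> node (d j) \<noteq> node (c j)"
proof -
  obtain i s where s: "solo_target ((blocked ^^ i) (c j)) = Some s"
    "neighbour n (node (c j)) s \<noteq> node (c (other_agent j))"
    using assms(2) unfolding can_evade_def by blast
  have c: "reachable c" "node (c A) \<noteq> node (c B)" "node (c k) < n" "port (c k) = None"
    "persistent (c k)" for k
    using assms(1) by (auto simp: running_def)
  obtain p where p: "path c p" "final c p = c(j := (blocked ^^ i) (c j))"
    using blocked_path[of c j, OF c(2,3) disjI1[OF c(4)]] by blast
  define x where "x = solo_step None ((blocked ^^ i) (c j))"
  define d where "d = c(j := x)"
  have "path (final c p) [({j}, None, d)]"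
    using path_solo[of "final c p" None j] c(2,4) by (simp add: p d_def x_def)
  then have leads: "leads c {j} d"
    using p unfolding leads_def
    by (intro exI[of _ "p @ [({j}, None, d)]"]) (simp add: path_append)
  have "\<not> terminated ((blocked ^^ i) (c j))"
    using c(5) unfolding persistent_def by blast
  then have x: "node x = neighbour n (node (c j)) s" "port x = None"
    using s(1) by (simp_all add: x_def solo_step_def active_update_def present_def)
  have dk: "d (other_agent j) = c (other_agent j)" by (simp add: d_def)
  have less: "node (d k) < n" for k
    using c(3) x neighbour_less size by (simp add: d_def)
  have apart: "node (d A) \<noteq> node (d B)"
    using s(2) x by (cases j) (auto simp: d_def)
  have reach: "reachable d" by (rule reachable_leads[OF c(1) leads])
  \<comment> \<open>Persistence of \<open>c j\<close> concerns only a blocked future and says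
    nothing after a move. It is regained from the other agent, whose state is untouched.\<close>
  have pers: "persistent (d j)"
    by (rule persistent_transfer[of d j, OF reach apart less]) (simp_all only: dk c)
  have "port (d k) = None \<and> persistent (d k)" for k
    using c x pers by (cases "k = j") (simp_all add: d_def)
  then have "running d"
    unfolding running_def using reach apart less by blast
  moreover have "node (d j) \<noteq> node (c j)"
    using x neighbour_neq size c(3) by (simp add: d_def)
  ultimately show ?thesis using dk leads by (intro exI[of _ d] conjI)
qed

text \<open>If all edges ever wanted lead to the other agent, they are one and the same edge, so the
  agents are in a standoff, contrary to their persistence.\<close>

lemma some_agent_can_evade:
  assumes "running c"
  shows "can_evade c j \<or> can_evade c (other_agent j)"
proof (rule ccontr)
  assume "\<not> ?thesis"
  then have "\<not> can_evade c k" for k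
    by (cases "k = j") (simp_all add: neq_agent_iff)
  then have none: "neighbour n (node (c k)) s = node (c (other_agent k))"
    if "solo_target ((blocked ^^ i) (c k)) = Some s" for k i s
    using that unfolding can_evade_def by blast
  have less: "node (c k) < n" for k using assms by (simp add: running_def)
  have same: "edge_at n (node (c k)) s = edge_at n (node (c l)) r"
    if "solo_target ((blocked ^^ i) (c k)) = Some s" "solo_target ((blocked ^^ i) (c l)) = Some r"
    for k l i s r
  proof (cases "k = l")
    case True
    then have "s = r"
      using neighbour_inj[OF size less[of k], of s r] none[OF that(1)] none[OF that(2)] by simp
    then show ?thesis using True by simp
  next
    case False
    then have "l = other_agent k" using neq_agent_iff[of l k] by simp
    then show ?thesis
      using connecting_edge_unique[OF size less[of k] less[of l], of s r]
        none[OF that(1)] none[OF that(2)] by simp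
  qed
  have "\<exists>e. \<forall>k s. solo_target ((blocked ^^ i) (c k)) = Some s \<longrightarrow> e = edge_at n (node (c k)) s" for i
  proof (cases "\<exists>k s. solo_target ((blocked ^^ i) (c k)) = Some s")
    case True
    then obtain k s where "solo_target ((blocked ^^ i) (c k)) = Some s" by (elim exE)
    from same[OF _ this] show ?thesis by (intro exI[of _ "edge_at n (node (c k)) s"]) simp
  qed simp
  then have "standoff c" using assms unfolding standoff_def running_def by blast
  then show False using standoff_not_persistent assms unfolding running_def by blast
qed

text \<open>Blocking \<open>j\<close> when it wants to move would leave it on a port and break the
  invariant. So \<open>j\<close> evades, or stays because it wants nothing, or waits until the other
  agent has moved out of its way.\<close>

lemma running_activate:
  assumes "running c"
  shows "\<exists>d. leads c {j} d \<and> running d"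
proof (cases "can_evade c j")
  case True
  from running_move[OF assms this] show ?thesis by blast
next
  case False
  show ?thesis
  proof (cases "solo_target (c j)")
    case None
    have c: "node (c A) \<noteq> node (c B)" "node (c k) < n" "port (c k) = None" "persistent (c k)" for k
      using assms by (auto simp: running_def)
    define d where "d = c(j := blocked (c j))"
    have "blocked (c j) = solo_step None (c j)" using None by (simp add: blocked_def)
    then have "leads c {j} d"
      unfolding leads_def d_def using path_solo[of c None j] c
      by (intro exI[of _ "[({j}, None, c(j := solo_step None (c j)))]"]) simp
    moreover have "persistent (blocked (c j))"
      using persistent_blocked_funpow[of "c j" 1] c by simp
    moreover have "port (blocked (c j)) = None"
      using None c by (simp add: blocked_def solo_step_def active_update_def)
    moreover have "reachable d"
      using reachable_leads assms calculation(1) unfolding running_def by blast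
    moreover have "node (d k) = node (c k)" for k by (simp add: d_def)
    ultimately have "running d"
      using c unfolding running_def by (simp add: d_def)
    then show ?thesis using \<open>leads c {j} d\<close> by blast
  next
    case (Some s)
    with False have s: "neighbour n (node (c j)) s = node (c (other_agent j))"
      unfolding can_evade_def by (metis funpow_0)
    have "can_evade c (other_agent j)" using some_agent_can_evade[OF assms, of j] False by simp
    from running_move[OF assms this] obtain d
      where d: "leads c {other_agent j} d" "running d" "d j = c j"
        "node (d (other_agent j)) \<noteq> node (c (other_agent j))"
      unfolding other_agent_simps by (elim exE conjE)
    \<comment> \<open>The state of \<open>j\<close> is unchanged, so it still wants \<open>s\<close>
      with no further blocking, and the node behind \<open>s\<close> has just been vacated.\<close>
    have "can_evade d j"
      unfolding can_evade_def by (rule exI[of _ 0]) (use Some s d in auto)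
    from running_move[OF d(2) this] obtain d' where d': "leads d {j} d'" "running d'" by blast
    have "leads c {j} d'" by (rule leads_mono[OF leads_trans[OF d(1) d'(1)]]) simp
    then show ?thesis using d'(2) by blast
  qed
qed

lemma contradiction: False
proof -
  define c :: "'m config" where
    "c = (\<lambda>j. \<lparr>node = (case j of A \<Rightarrow> 0 | B \<Rightarrow> 1), port = None, memory = start_memory P, moved = False\<rparr>)"
  have c: "initial P n c" "node (c A) \<noteq> node (c B)"
    using size by (auto simp: initial_def c_def split: agent.split)
  have "leads c {} c" unfolding leads_def by (intro exI[of _ "[]"]) simp
  then have reach: "reachable c" using c(1) unfolding reachable_def by blast
  then have run: "running c"
    using c initial_persistent[of c, OF c] unfolding running_def initial_def by blast
  \<comment> \<open>Activating \<open>A\<close> and then \<open>B\<close> makes the invariant recur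
    fairly forever, although correctness demands that \<open>A\<close> terminate.\<close>
  have closed: "\<exists>d. leads c UNIV d \<and> running d" if "running c" for c
  proof -
    obtain d where d: "leads c {A} d" "running d" using running_activate[OF \<open>running c\<close>, of A] by blast
    obtain d' where d': "leads d {B} d'" "running d'" using running_activate[OF d(2), of B] by blast
    have "UNIV = {A} \<union> {B}" using agent.exhaust by auto
    then show ?thesis using leads_trans[OF d(1) d'(1)] d'(2) by auto
  qed
  obtain d where "running d" "terminated (d A)"
    using recurrent_terminated[of c running A, OF reach run closed] by blast
  then show False using persistent_not_terminated unfolding running_def by blast
qed

end

theorem theorem11:
  fixes n :: nat and landmark :: "nat option" and chirality :: bool and P :: "'m protocol"
  assumes "n \<ge> 3"
    and "\<And>l. landmark = Some l \<Longrightarrow> l < n"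
  shows "\<not> solves_exploration_with_explicit_termination n landmark chirality P"
proof
  assume "solves_exploration_with_explicit_termination n landmark chirality P"
  moreover have "bij (\<lambda>s. case s of Minus \<Rightarrow> Left | Plus \<Rightarrow> Right)"
  proof (rule bijI')
    show "\<exists>s. d = (case s of Minus \<Rightarrow> Left | Plus \<Rightarrow> Right)" for d
      by (cases d) (auto intro: exI[of _ Minus] exI[of _ Plus])
  qed (simp split: side.split)
  ultimately interpret explicit_termination n landmark chirality P
    "\<lambda>s. case s of Minus \<Rightarrow> Left | Plus \<Rightarrow> Right"
    using assms(1) by unfold_locales
  show False by (rule contradiction)
qed

end
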